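(* Let $a>0$, $\lambda\in\mathbb{R}_+$ and $c\in\mathbb{R}\setminus[-1,+\infty)$. The polynomials $\tilde{Q}_{n}^{\lambda}(x)=\lambda_{n-1}^{c}\,Q_{n}^{\lambda}(x)$, where $\lambda_{n-1}^{c}=1+\lambda K_{n-1}^{(1,1)}(c,c)$, can be represented as $$\tilde{Q}_{n}^{\lambda}(x)=C_{n}^{(a)}(x)+\lambda K_{n-1}^{(1,1)}(c,c)\,G_{n}^{(a)}(x),$$ and $K_{n-1}^{(1,1)}(c,c)>0$ for every $n\in\mathbb{N}$.
   Context: Let $a>0$ and let $\psi^{(a)}$ be the Poisson distribution, the discrete measure with mass $e^{-a}a^{x}/x!$ at $x=0,1,2,\ldots$. $\Delta f(x)=f(x+1)-f(x)$. $\{C_n^{(a)}\}_{n\ge0}$ are the monic Charlier polynomials, orthogonal with respect to $\langle p,q\rangle=\int_0^\infty pq\,d\psi^{(a)}$; $C_{-1}^{(a)}=0$, $C_0^{(a)}=1$, $C_{n+1}^{(a)}(x)=(x-n-a)C_n^{(a)}(x)-na\,C_{n-1}^{(a)}(x)$, $\|C_n^{(a)}\|^2=n!a^n$. $\{Q_n^\lambda\}_{n\ge0}$ is the sequence of monic polynomials ($\deg Q_n^\lambda=n$) orthogonal with respect to $\langle p,q\rangle_\lambda=\int_0^\infty pq\,d\psi^{(a)}+\lambda\,\Delta p(c)\,\Delta q(c)$. $$K_{n}^{(0,1)}(x,c)=\sum_{k=0}^{n}\frac{C_k^{(a)}(x)\,\Delta C_k^{(a)}(c)}{\|C_k^{(a)}\|^2},\qquad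 K_{n}^{(1,1)}(c,c)=\sum_{k=0}^{n}\frac{[\Delta C_k^{(a)}(c)]^2}{\|C_k^{(a)}\|^2},$$ $$G_{n}^{(a)}(x)=\lim_{\lambda\to\infty}Q_n^\lambda(x)=C_{n}^{(a)}(x)-\frac{\Delta C_{n}^{(a)}(c)}{K_{n-1}^{(1,1)}(c,c)}K_{n-1}^{(0,1)}(x,c).$$
   Formalization: Positivity of K_{n-1}^{(1,1)}(c,c) is stated for n ≥ 2 only, since K_0^{(1,1)}(c,c) = 0 because ΔC_0 = 0; G_n is taken as the limit of Q_n^λ as λ→∞, which also makes sense for n ≤ 1, where the explicit formula is 0/0. *)

theory Defs
  imports "HOL-Probability.Probability" "HOL-Computational_Algebra.Polynomial"
begin

definition poisson_real :: "real \<Rightarrow> real measure" where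
  "poisson_real a = measure_pmf (map_pmf real (poisson_pmf a))"

lemma emeasure_poisson_real:
  assumes "0 < a"
  shows "emeasure (poisson_real a) {real k} = ennreal (exp (- a) * a ^ k / fact k)"
proof -
  have "pmf (map_pmf real (poisson_pmf a)) (real k) = pmf (poisson_pmf a) k"
    by (rule pmf_map_inj') simp
  with assms show ?thesis
    by (simp add: poisson_real_def emeasure_pmf_single mult.commute)
qed

definition charlier_ip :: "real \<Rightarrow> real poly \<Rightarrow> real poly \<Rightarrow> real" where
  "charlier_ip a p q = (LINT x:{0..}|poisson_real a. poly p x * poly q x)"

text \<open>The three-term recurrence; the second equation uses the convention that
  the polynomial of index \<open>-1\<close> is zero.\<close>

fun charlier :: "real \<Rightarrow> nat \<Rightarrow> real poly" where
  "charlier a 0 = 1"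
| "charlier a (Suc 0) = [:- a, 1:]"
| "charlier a (Suc (Suc n)) =
     [:- (real (Suc n) + a), 1:] * charlier a (Suc n)
       - smult (real (Suc n) * a) (charlier a n)"

definition fdiff :: "(real \<Rightarrow> real) \<Rightarrow> real \<Rightarrow> real" where
  "fdiff f x = f (x + 1) - f x"

definition sobolev_ip :: "real \<Rightarrow> real \<Rightarrow> real \<Rightarrow> real poly \<Rightarrow> real poly \<Rightarrow> real" where
  "sobolev_ip a c l p q = charlier_ip a p q + l * fdiff (poly p) c * fdiff (poly q) c"

definition monic_orthogonal ::
  "(real poly \<Rightarrow> real poly \<Rightarrow> real) \<Rightarrow> (nat \<Rightarrow> real poly) \<Rightarrow> bool" where
  "monic_orthogonal ip P \<longleftrightarrow>
     (\<forall>n. degree (P n) = n \<and> lead_coeff (P n) = 1) \<and>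
     (\<forall>m n. m \<noteq> n \<longrightarrow> ip (P m) (P n) = 0)"

text \<open>For \<open>a > 0\<close> and \<open>l \<ge> 0\<close> the form \<^term>\<open>sobolev_ip a c l\<close> is positive
  definite, so the sequence described here exists and is unique.\<close>

definition sobolev_charlier :: "real \<Rightarrow> real \<Rightarrow> real \<Rightarrow> nat \<Rightarrow> real poly" where
  "sobolev_charlier a c l = (THE P. monic_orthogonal (sobolev_ip a c l) P)"

text \<open>The kernel is indexed by integers so that the index \<open>n - 1\<close> with \<open>n = 0\<close>
  denotes the empty sum.\<close>

definition kernel11 :: "real \<Rightarrow> real \<Rightarrow> int \<Rightarrow> real" where
  "kernel11 a c m =
     (\<Sum>k | int k \<le> m. (fdiff (poly (charlier a k)) c)\<^sup>2
        / charlier_ip a (charlier a k) (charlier a k))"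

text \<open>The forward difference of a constant vanishes, so the kernel is strictly positive
  only from index \<open>1\<close> on.\<close>

lemma kernel11_0: "kernel11 a c 0 = 0"
proof -
  have "{k. int k \<le> 0} = {0}" by auto
  then show ?thesis by (simp add: kernel11_def fdiff_def)
qed

text \<open>Pointwise limit of the orthogonal polynomials as the mass tends to infinity. With
  \<open>C = charlier a\<close>, for \<open>n \<ge> 2\<close> its value at \<open>x\<close> is
  \<open>C n x - \<Delta>C n c / kernel11 a c (n - 1) * (\<Sum>k<n. C k x * \<Delta>C k c / \<parallel>C k\<parallel>^2)\<close>.
  For \<open>n \<le> 1\<close> the kernel in the denominator and the sum both vanish, and the limit is
  \<open>C n x\<close>.\<close>

definition limit_charlier :: "real \<Rightarrow> real \<Rightarrow> nat \<Rightarrow> real \<Rightarrow> real" where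
  "limit_charlier a c n x = Lim at_top (\<lambda>l. poly (sobolev_charlier a c l n) x)"

definition scaled_sobolev_charlier :: "real \<Rightarrow> real \<Rightarrow> real \<Rightarrow> nat \<Rightarrow> real poly" where
  "scaled_sobolev_charlier a c l n =
     smult (1 + l * kernel11 a c (int n - 1)) (sobolev_charlier a c l n)"

end

theory Submission
  imports Defs
begin

text \<open>The Poisson functional satisfies Stein's identity \<open>E[X f(X)] = a E[f(X + 1)]\<close>.
  Together with the raising relation \<open>C_(n+1)(x) = x C_n(x - 1) - a C_n(x)\<close> it shows that
  the Charlier polynomials of positive index have mean zero; the three-term recurrence then
  propagates this to orthogonality. The kernel \<open>K_(n-1)^(0,1)(\<cdot>, c)\<close> represents
  \<open>p \<mapsto> \<Delta>p(c)\<close> on polynomials of degree below \<open>n\<close>, so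
  \<open>Q_n = C_n - l \<Delta>C_n(c) / (1 + l K_(n-1)^(1,1)(c,c)) K_(n-1)^(0,1)(\<cdot>, c)\<close>,
  from which the limit and the claimed identity are read off.\<close>

subsection \<open>Moments of the Poisson distribution\<close>

text \<open>The moment functional of the weight, taken over \<open>nat\<close> so that expectations
  become series whose index can be shifted.\<close>

definition poisson_mean :: "real \<Rightarrow> real poly \<Rightarrow> real" where
  "poisson_mean a p = measure_pmf.expectation (poisson_pmf a) (\<lambda>k. poly p (real k))"

lemma pmf_poisson_Suc:
  assumes "0 < a"
  shows "pmf (poisson_pmf a) (Suc k) * real (Suc k) = a * pmf (poisson_pmf a) k"
  using assms by (simp add: field_simps del: of_nat_Suc)

lemma integrable_pmf_nat_iff:
  fixes f :: "nat \<Rightarrow> real"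
  shows "integrable (measure_pmf p) f \<longleftrightarrow> summable (\<lambda>k. \<bar>pmf p k * f k\<bar>)"
proof -
  have "integrable (measure_pmf p) f \<longleftrightarrow> integrable (count_space UNIV) (\<lambda>k. pmf p k *\<^sub>R f k)"
    unfolding measure_pmf_eq_density by (rule integrable_density) auto
  then show ?thesis by (simp add: integrable_count_space_nat_iff)
qed

lemma integral_pmf_nat:
  fixes f :: "nat \<Rightarrow> real"
  assumes "integrable (measure_pmf p) f"
  shows "measure_pmf.expectation p f = (\<Sum>k. pmf p k * f k)"
proof -
  have "integral\<^sup>L (measure_pmf p) f = integral\<^sup>L (count_space UNIV) (\<lambda>k. pmf p k *\<^sub>R f k)"
    unfolding measure_pmf_eq_density by (rule integral_density) auto
  moreover have "integrable (count_space UNIV) (\<lambda>k. pmf p k *\<^sub>R f k)"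
    using assms by (simp add: integrable_pmf_nat_iff integrable_count_space_nat_iff)
  ultimately show ?thesis
    by (simp add: integral_count_space_nat)
qed

text \<open>Shifting the summation index turns the weight relation \<open>pmf_poisson_Suc\<close>
  into the identity. Integrability on the left is a conclusion, so the lemma can drive an induction
  on the degree.\<close>

lemma poisson_stein:
  fixes f :: "nat \<Rightarrow> real"
  assumes a: "0 < a" and f: "integrable (poisson_pmf a) (\<lambda>k. f (Suc k))"
  shows "integrable (poisson_pmf a) (\<lambda>k. real k * f k)" (is ?I)
    and "measure_pmf.expectation (poisson_pmf a) (\<lambda>k. real k * f k) =
         a * measure_pmf.expectation (poisson_pmf a) (\<lambda>k. f (Suc k))" (is ?E)
proof -
  let ?p = "pmf (poisson_pmf a)"
  have shift: "?p (Suc k) * (real (Suc k) * f (Suc k)) = a * (?p k * f (Suc k))" for k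
    using pmf_poisson_Suc[OF a, of k] by (metis mult.assoc)
  have sf: "summable (\<lambda>k. \<bar>?p k * f (Suc k)\<bar>)"
    using f by (simp only: integrable_pmf_nat_iff)
  have "summable (\<lambda>k. \<bar>?p (Suc k) * (real (Suc k) * f (Suc k))\<bar>)"
    unfolding shift abs_mult[of a] by (rule summable_mult[OF sf])
  then have sk: "summable (\<lambda>k. \<bar>?p k * (real k * f k)\<bar>)"
    by (subst summable_Suc_iff[symmetric])
  then show I: ?I by (simp only: integrable_pmf_nat_iff)
  \<comment> \<open>The factor \<open>real k\<close> kills the term at \<open>k = 0\<close>, so no
    boundary term remains.\<close>
  have "(\<Sum>k. ?p k * (real k * f k)) = (\<Sum>k. ?p (Suc k) * (real (Suc k) * f (Suc k)))"
    using suminf_split_head[OF summable_rabs_cancel[OF sk]] by simp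
  also have "\<dots> = a * (\<Sum>k. ?p k * f (Suc k))"
    unfolding shift by (rule suminf_mult[OF summable_rabs_cancel[OF sf]])
  finally show ?E
    by (simp only: integral_pmf_nat[OF I] integral_pmf_nat[OF f])
qed

text \<open>By Stein's identity \<open>x * q x\<close> is integrable once \<open>q (x + 1)\<close>
  is, and the latter has smaller degree.\<close>

lemma integrable_poisson_poly:
  assumes a: "0 < a"
  shows "integrable (poisson_pmf a) (\<lambda>k. poly p (real k))"
proof (induction "degree p" arbitrary: p rule: less_induct)
  case less
  obtain c q where p: "p = pCons c q" by (cases p) auto
  show ?case
  proof (cases "q = 0")
    case True
    then show ?thesis by (simp add: p)
  next
    case False
    have "degree (pcompose q [:1, 1:]) < degree p"
      using False by (simp add: p degree_pcompose)
    from less[OF this] have "integrable (poisson_pmf a) (\<lambda>k. poly q (real (Suc k)))"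
      by (simp add: poly_pcompose add.commute)
    from poisson_stein(1)[OF a, of "\<lambda>k. poly q (real k)", OF this] show ?thesis
      by (simp add: p)
  qed
qed

lemma poisson_mean_add:
  "0 < a \<Longrightarrow> poisson_mean a (p + q) = poisson_mean a p + poisson_mean a q"
  by (simp add: poisson_mean_def integrable_poisson_poly)

lemma poisson_mean_smult: "poisson_mean a (smult c p) = c * poisson_mean a p"
  by (simp add: poisson_mean_def)

lemma poisson_mean_diff:
  "0 < a \<Longrightarrow> poisson_mean a (p - q) = poisson_mean a p - poisson_mean a q"
  by (simp add: poisson_mean_def integrable_poisson_poly)

lemma poisson_mean_shift:
  assumes "0 < a"
  shows "poisson_mean a ([:0, 1:] * pcompose p [:-1, 1:]) = a * poisson_mean a p"
proof -
  have "integrable (poisson_pmf a) (\<lambda>k. poly p (real (Suc k) - 1))"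
    using integrable_poisson_poly[OF assms, of p] by simp
  from poisson_stein(2)[OF assms, of "\<lambda>k. poly p (real k - 1)", OF this] show ?thesis
    by (simp add: poisson_mean_def poly_pcompose algebra_simps)
qed

text \<open>A nonzero polynomial has finitely many roots, so it is nonzero at some natural number,
  and every natural number has positive mass.\<close>

lemma poisson_mean_square_pos:
  assumes a: "0 < a" and p: "p \<noteq> 0"
  shows "0 < poisson_mean a (p * p)"
proof -
  obtain k where k: "poly p (real k) \<noteq> 0"
  proof -
    have "finite {x. poly p x = 0}" using p by (rule poly_roots_finite)
    then have "\<not> range real \<subseteq> {x. poly p x = 0}"
      using infinite_super range_inj_infinite[OF inj_of_nat] by blast
    then show ?thesis using that by auto
  qed
  let ?f = "\<lambda>j. pmf (poisson_pmf a) j * poly (p * p) (real j)"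
  have I: "integrable (poisson_pmf a) (\<lambda>j. poly (p * p) (real j))"
    by (rule integrable_poisson_poly[OF a])
  have "0 < (\<Sum>j. ?f j)"
  proof (rule suminf_pos2)
    show "summable ?f"
      using I by (simp only: integrable_pmf_nat_iff) (rule summable_rabs_cancel)
    show "0 \<le> ?f j" for j by (simp add: pmf_nonneg)
    have "0 < pmf (poisson_pmf a) k" using a by simp
    moreover have "0 < poly (p * p) (real k)"
      using k by (simp add: zero_less_mult_iff linorder_neq_iff disj_commute)
    ultimately show "0 < ?f k" by (rule mult_pos_pos)
  qed
  then show ?thesis by (simp only: poisson_mean_def integral_pmf_nat[OF I])
qed

lemma charlier_ip_eq: "charlier_ip a p q = poisson_mean a (p * q)"
  by (simp add: charlier_ip_def poisson_real_def poisson_mean_def set_lebesgue_integral_def)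

subsection \<open>Orthogonality of the Charlier polynomials\<close>

lemma degree_charlier: "degree (charlier a n) = n"
  and lead_coeff_charlier: "lead_coeff (charlier a n) = 1"
proof -
  have "degree (charlier a n) = n \<and> lead_coeff (charlier a n) = 1"
  proof (induction a n rule: charlier.induct)
    case (3 a n)
    let ?A = "[:- (real (Suc n) + a), 1:] * charlier a (Suc n)"
    let ?B = "smult (real (Suc n) * a) (charlier a n)"
    have ne: "charlier a (Suc n) \<noteq> 0" using 3 by force
    have dA: "degree ?A = Suc (Suc n)" using 3 ne by (subst degree_mult_eq) auto
    have lA: "lead_coeff ?A = 1"
    proof -
      have "lead_coeff [:- (real (Suc n) + a), 1:] = 1" by simp
      moreover have "lead_coeff (charlier a (Suc n)) = 1" using 3 by blast
      ultimately show ?thesis by (simp only: lead_coeff_mult mult_1)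
    qed
    have dB: "degree ?B < Suc (Suc n)"
      using 3 degree_smult_le[of "real (Suc n) * a" "charlier a n"] by linarith
    have "degree (?A - ?B) = Suc (Suc n)"
      using dA dB degree_add_eq_left[of "- ?B" ?A] by simp
    moreover have "coeff (?A - ?B) (Suc (Suc n)) = 1"
      using lA dA coeff_eq_0[OF dB] by simp
    ultimately show ?case by (simp only: charlier.simps)
  qed auto
  then show "degree (charlier a n) = n" "lead_coeff (charlier a n) = 1" by auto
qed

lemma charlier_raising:
  "poly (charlier a (Suc n)) x = x * poly (charlier a n) (x - 1) - a * poly (charlier a n) x"
proof (induction a n rule: charlier.induct)
  case (3 a n)
  define A B where "A = poly (charlier a (Suc n)) (x - 1)" and "B = poly (charlier a n) (x - 1)"
  define U V where "U = poly (charlier a (Suc n)) x" and "V = poly (charlier a n) x"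
  have IH: "poly (charlier a (Suc (Suc n))) x = x * A - a * U" "U = x * B - a * V"
    using 3 unfolding A_def B_def U_def V_def by auto
  have rec: "poly (charlier a (Suc (Suc m))) y =
      (y - real (Suc m) - a) * poly (charlier a (Suc m)) y - real (Suc m) * a * poly (charlier a m) y"
    for m y by (simp add: algebra_simps)
  have 1: "poly (charlier a (Suc (Suc n))) (x - 1) =
      (x - 1 - real (Suc n) - a) * A - real (Suc n) * a * B"
    unfolding A_def B_def by (rule rec)
  have 2: "x * A - a * U = (x - real (Suc n) - a) * U - real (Suc n) * a * V"
    using rec[of n x] IH(1) unfolding U_def V_def by simp
  have "poly (charlier a (Suc (Suc (Suc n)))) x =
      (x - real (Suc (Suc n)) - a) * (x * A - a * U) - real (Suc (Suc n)) * a * U"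
    using rec[of "Suc n" x] IH(1) unfolding U_def by simp
  \<comment> \<open>The two sides differ by \<open>a * (x * A + (n + 1) * x * B - x * U)\<close>;
    this vanishes after \<open>x * B\<close> is replaced by \<open>U + a * V\<close> and
    \<open>x * A\<close> is taken from equation \<open>2\<close>.\<close>
  also have "\<dots> = x * ((x - 1 - real (Suc n) - a) * A - real (Suc n) * a * B) - a * (x * A - a * U)"
    using IH(2) 2 by (simp add: algebra_simps) algebra
  finally show ?case using 1 IH(1) by simp
qed (simp_all add: algebra_simps)

text \<open>Stein's identity gives the two terms of the raising relation the same mean, so they
  cancel.\<close>

lemma poisson_mean_charlier_Suc:
  assumes "0 < a"
  shows "poisson_mean a (charlier a (Suc n)) = 0"
proof -
  have "charlier a (Suc n) =
      [:0, 1:] * pcompose (charlier a n) [:-1, 1:] - smult a (charlier a n)"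
    by (rule poly_ext) (simp add: charlier_raising poly_pcompose del: charlier.simps)
  then show ?thesis
    by (simp only: poisson_mean_diff[OF assms] poisson_mean_smult poisson_mean_shift[OF assms])
qed

text \<open>The recurrence solved for the product with \<open>x\<close>. At \<open>n = 0\<close> the
  truncated index \<open>n - 1\<close> is harmless because its coefficient is zero.\<close>

lemma charlier_times_x:
  "[:0, 1:] * charlier a n =
     charlier a (Suc n) + smult (real n + a) (charlier a n)
       + smult (real n * a) (charlier a (n - 1))"
  by (rule poly_ext, cases n) (simp_all add: algebra_simps)

text \<open>Multiplication by \<open>x\<close> is symmetric for the functional. Expanding it on
  either factor and comparing leaves only the product with the raised smaller index.\<close>

lemma poisson_mean_charlier_orthogonal_less:
  assumes a: "0 < a"
  shows "m < n \<Longrightarrow> poisson_mean a (charlier a m * charlier a n) = 0"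
proof (induction m arbitrary: n rule: less_induct)
  case (less m)
  show ?case
  proof (cases m)
    case 0
    then show ?thesis
      using less.prems poisson_mean_charlier_Suc[OF a, of "n - 1"] by simp
  next
    case (Suc k)
    let ?C = "charlier a" and ?L = "poisson_mean a"
    have *: "?L ([:0, 1:] * ?C i * ?C j) = ?L (?C (Suc i) * ?C j)
        + (real i + a) * ?L (?C i * ?C j) + real i * a * ?L (?C (i - 1) * ?C j)" for i j
      by (simp only: charlier_times_x distrib_right[where 'a = "real poly"] poisson_mean_add[OF a]
          poisson_mean_smult mult_smult_left)
    have sym: "?L ([:0, 1:] * ?C k * ?C n) = ?L ([:0, 1:] * ?C n * ?C k)"
      by (simp only: mult.assoc mult.commute[of "?C k"])
    have "?L (?C i * ?C j) = 0" if "i < m" "i < j" for i j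
      using less.IH that by blast
    \<comment> \<open>Each of these products has a factor of index at most \<open>k\<close>, below
      \<open>m\<close>, and a partner of larger index.\<close>
    then have z: "?L (?C k * ?C n) = 0" "?L (?C n * ?C k) = 0" "?L (?C (Suc n) * ?C k) = 0"
        "?L (?C (n - 1) * ?C k) = 0" "?L (?C (k - 1) * ?C n) = 0"
      using less.prems Suc by (auto simp only: mult.commute[of _ "?C k"])
    from *[of k n] *[of n k] sym z show ?thesis using Suc by simp
  qed
qed

lemma charlier_ip_charlier_eq_0:
  assumes "0 < a" "m \<noteq> n"
  shows "charlier_ip a (charlier a m) (charlier a n) = 0"
  using assms poisson_mean_charlier_orthogonal_less[of a m n]
    poisson_mean_charlier_orthogonal_less[of a n m]
  by (auto simp: charlier_ip_eq mult.commute linorder_neq_iff)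

lemma charlier_ip_pos:
  assumes "0 < a" "p \<noteq> 0"
  shows "0 < charlier_ip a p p"
  using poisson_mean_square_pos[OF assms] by (simp only: charlier_ip_eq)

lemma charlier_ip_charlier_pos:
  assumes "0 < a"
  shows "0 < charlier_ip a (charlier a n) (charlier a n)"
  using lead_coeff_charlier[of a n] by (intro charlier_ip_pos[OF assms]) auto

subsection \<open>Uniqueness of monic orthogonal sequences\<close>

text \<open>The bound \<open>\<forall>i\<ge>n. coeff p i = 0\<close> replaces \<open>degree p < n\<close> so that \<open>n = 0\<close> forces
  \<open>p = 0\<close>.\<close>

lemma linear_functional_eq_0:
  fixes F :: "real poly \<Rightarrow> real"
  assumes add: "\<And>p q. F (p + q) = F p + F q" and smult: "\<And>r p. F (smult r p) = r * F p"
    and monic: "\<And>k. degree (P k) = k" "\<And>k. lead_coeff (P k) = 1"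
    and zero: "\<And>k. k < n \<Longrightarrow> F (P k) = 0"
    and p: "\<forall>i\<ge>n. coeff p i = 0"
  shows "F p = 0"
  using zero p
proof (induction n arbitrary: p)
  case 0
  then have "p = smult 0 p" by (simp add: poly_eq_iff)
  then show ?case using smult[of 0 p] by simp
next
  case (Suc n)
  \<comment> \<open>As \<open>P n\<close> is monic, this removes the coefficient at \<open>n\<close>
    and lowers the bound by one.\<close>
  let ?r = "p - smult (coeff p n) (P n)"
  have coeff_r: "coeff ?r i = 0" if "i \<ge> n" for i
  proof (cases "i = n")
    case True
    then show ?thesis using monic[of n] by simp
  next
    case False
    then show ?thesis using that Suc.prems(2) monic(1)[of n] by (simp add: coeff_eq_0)
  qed
  have "F ?r = 0"
  proof (rule Suc.IH)
    show "F (P k) = 0" if "k < n" for k using Suc.prems(1)[of k] that by linarith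
    show "\<forall>i\<ge>n. coeff ?r i = 0" using coeff_r by blast
  qed
  moreover have "F p = F ?r + coeff p n * F (P n)"
    using add[of ?r "smult (coeff p n) (P n)"] smult by simp
  ultimately show ?case using Suc.prems(1)[of n] by simp
qed

text \<open>The leading terms of \<open>P n\<close> and \<open>Q n\<close> cancel, so their
  difference is orthogonal to both, hence to itself.\<close>

lemma monic_orthogonal_unique:
  assumes add: "\<And>p q r. ip p (q + r) = ip p q + ip p r"
    and smult: "\<And>c p q. ip p (smult c q) = c * ip p q"
    and sym: "\<And>p q. ip p q = ip q p"
    and pos: "\<And>p. p \<noteq> 0 \<Longrightarrow> 0 < ip p p"
    and P: "monic_orthogonal ip P" and Q: "monic_orthogonal ip Q"
  shows "P = Q"
proof
  fix n
  let ?d = "P n - Q n"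
  have dP: "degree (P k) = k" "lead_coeff (P k) = 1" for k
    using P unfolding monic_orthogonal_def by blast+
  have dQ: "degree (Q k) = k" "lead_coeff (Q k) = 1" for k
    using Q unfolding monic_orthogonal_def by blast+
  have d: "\<forall>i\<ge>n. coeff ?d i = 0"
  proof (intro allI impI)
    fix i assume "i \<ge> n"
    then show "coeff ?d i = 0"
      using dP[of n] dQ[of n] by (cases "i = n") (auto simp: coeff_eq_0)
  qed
  have "ip (P n) ?d = 0"
    by (rule linear_functional_eq_0[OF add smult dP _ d]) (use P in \<open>auto simp: monic_orthogonal_def\<close>)
  moreover have "ip (Q n) ?d = 0"
    by (rule linear_functional_eq_0[OF add smult dQ _ d]) (use Q in \<open>auto simp: monic_orthogonal_def\<close>)
  moreover have "ip (P n) ?d = ip ?d ?d + ip (Q n) ?d"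
    using add[of ?d ?d "Q n"] sym by simp
  ultimately have "ip ?d ?d = 0" by simp
  then show "P n = Q n" using pos[of ?d] by fastforce
qed

subsection \<open>The Sobolev-type polynomials\<close>

text \<open>This is \<open>K_(n-1)^(0,1)(x, c)\<close> as a polynomial in \<open>x\<close>; the
  index is shifted so that \<open>n = 0\<close> gives the empty sum.\<close>

definition kernel01_poly :: "real \<Rightarrow> real \<Rightarrow> nat \<Rightarrow> real poly" where
  "kernel01_poly a c n = (\<Sum>k<n. smult (fdiff (poly (charlier a k)) c
     / charlier_ip a (charlier a k) (charlier a k)) (charlier a k))"

text \<open>Expanding \<open>Q_n\<close> in the Charlier basis gives \<open>C_n\<close> minus
  \<open>l\<close> times \<Delta>\<open>Q_n(c)\<close> times the kernel polynomial. Differencing at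
  \<open>c\<close> and solving for \<Delta>\<open>Q_n(c)\<close> produces the quotient used
  here.\<close>

definition sobolev_charlier_explicit :: "real \<Rightarrow> real \<Rightarrow> real \<Rightarrow> nat \<Rightarrow> real poly" where
  "sobolev_charlier_explicit a c l n = charlier a n -
     smult (l * fdiff (poly (charlier a n)) c / (1 + l * kernel11 a c (int n - 1)))
       (kernel01_poly a c n)"

section \<open>Sign and vanishing of the kernel\<close>

lemma kernel11_eq_sum:
  "kernel11 a c (int n - 1) =
     (\<Sum>k<n. (fdiff (poly (charlier a k)) c)\<^sup>2 / charlier_ip a (charlier a k) (charlier a k))"
proof -
  have "{k. int k \<le> int n - 1} = {..<n}" by auto
  then show ?thesis by (simp add: kernel11_def)
qed

lemma kernel11_nonneg:
  assumes "0 < a"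
  shows "0 \<le> kernel11 a c (int n - 1)"
  unfolding kernel11_eq_sum
  by (intro sum_nonneg divide_nonneg_pos charlier_ip_charlier_pos assms) simp

text \<open>The term of index 1 is already positive, since \<open>C_1\<close> is monic of degree one
  and has forward difference 1; it enters the sum once \<open>n\<close> is at least 2.\<close>

lemma kernel11_pos:
  assumes "0 < a" "2 \<le> n"
  shows "0 < kernel11 a c (int n - 1)"
  unfolding kernel11_eq_sum
proof (rule sum_pos2[where i = 1])
  show "0 < (fdiff (poly (charlier a 1)) c)\<^sup>2 / charlier_ip a (charlier a 1) (charlier a 1)"
    using charlier_ip_charlier_pos[OF assms(1), of 1] by (simp add: fdiff_def)
  show "0 \<le> (fdiff (poly (charlier a i)) c)\<^sup>2 / charlier_ip a (charlier a i) (charlier a i)" for i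
    using charlier_ip_charlier_pos[OF assms(1), of i] by simp
qed (use assms in auto)

text \<open>A vanishing sum of nonnegative terms forces every coefficient of the kernel polynomial
  to vanish. This settles the cases where a division by the kernel is a division by zero.\<close>

lemma kernel01_poly_eq_0:
  assumes a: "0 < a" and K: "kernel11 a c (int n - 1) = 0"
  shows "kernel01_poly a c n = 0"
proof -
  let ?t = "\<lambda>k. (fdiff (poly (charlier a k)) c)\<^sup>2 / charlier_ip a (charlier a k) (charlier a k)"
  have "0 \<le> ?t k" for k using charlier_ip_charlier_pos[OF a, of k] by simp
  then have "\<forall>k\<in>{..<n}. ?t k = 0"
    using K sum_nonneg_eq_0_iff[of "{..<n}" ?t] unfolding kernel11_eq_sum by simp
  then show ?thesis
    using charlier_ip_charlier_pos[OF a] by (force simp: kernel01_poly_def intro!: sum.neutral)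
qed

section \<open>Linearity rules and the reproducing property\<close>

lemma fdiff_poly_add: "fdiff (poly (p + q)) c = fdiff (poly p) c + fdiff (poly q) c"
  by (simp add: fdiff_def)

lemma fdiff_poly_smult: "fdiff (poly (smult r p)) c = r * fdiff (poly p) c"
  by (simp add: fdiff_def right_diff_distrib)

lemma fdiff_poly_diff: "fdiff (poly (p - q)) c = fdiff (poly p) c - fdiff (poly q) c"
  by (simp add: fdiff_def)

lemma fdiff_kernel01_poly: "fdiff (poly (kernel01_poly a c n)) c = kernel11 a c (int n - 1)"
  unfolding kernel11_eq_sum kernel01_poly_def
  by (simp add: fdiff_def poly_sum sum_subtractf[symmetric] power2_eq_square
      diff_divide_distrib add_divide_distrib algebra_simps)

lemma charlier_ip_commute: "charlier_ip a p q = charlier_ip a q p"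
  by (simp add: charlier_ip_eq mult.commute)

lemma charlier_ip_add_right:
  "0 < a \<Longrightarrow> charlier_ip a p (q + r) = charlier_ip a p q + charlier_ip a p r"
  by (simp add: charlier_ip_eq distrib_left poisson_mean_add)

lemma charlier_ip_smult_right: "charlier_ip a p (smult r q) = r * charlier_ip a p q"
  by (simp add: charlier_ip_eq poisson_mean_smult)

lemma charlier_ip_diff_left:
  "0 < a \<Longrightarrow> charlier_ip a (p - q) r = charlier_ip a p r - charlier_ip a q r"
  by (simp add: charlier_ip_eq left_diff_distrib poisson_mean_diff)

lemma charlier_ip_smult_left: "charlier_ip a (smult r p) q = r * charlier_ip a p q"
  by (simp add: charlier_ip_eq poisson_mean_smult)

lemma charlier_ip_sum_left:
  assumes "0 < a" "finite A"
  shows "charlier_ip a (\<Sum>k\<in>A. f k) q = (\<Sum>k\<in>A. charlier_ip a (f k) q)"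
  using assms(2)
  by (induction) (use charlier_ip_add_right[OF assms(1), of q] charlier_ip_smult_right[of a q 0 0]
      in \<open>simp_all add: charlier_ip_commute[of a _ q]\<close>)

text \<open>Both sides are linear in \<open>p\<close>, so it suffices to test
  \<open>charlier a j\<close> for \<open>j < n\<close>; orthogonality leaves the term
  \<open>k = j\<close>, where the norm cancels.\<close>

lemma kernel01_poly_reproducing:
  assumes a: "0 < a" and p: "\<forall>i\<ge>n. coeff p i = 0"
  shows "charlier_ip a (kernel01_poly a c n) p = fdiff (poly p) c"
proof -
  have "charlier_ip a (kernel01_poly a c n) p - fdiff (poly p) c = 0"
  proof (rule linear_functional_eq_0[where P = "charlier a" and n = n,
        OF _ _ degree_charlier lead_coeff_charlier _ p])
    fix j assume j: "j < n"
    have "charlier_ip a (kernel01_poly a c n) (charlier a j) =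
        (\<Sum>k<n. fdiff (poly (charlier a k)) c / charlier_ip a (charlier a k) (charlier a k)
           * charlier_ip a (charlier a k) (charlier a j))"
      by (simp add: kernel01_poly_def charlier_ip_sum_left[OF a] charlier_ip_smult_left)
    also have "\<dots> = (\<Sum>k<n. if k = j then fdiff (poly (charlier a j)) c else 0)"
      using charlier_ip_charlier_pos[OF a, of j]
      by (intro sum.cong) (auto simp: charlier_ip_charlier_eq_0[OF a])
    also have "\<dots> = fdiff (poly (charlier a j)) c" using j by simp
    finally show "charlier_ip a (kernel01_poly a c n) (charlier a j)
        - fdiff (poly (charlier a j)) c = 0" by simp
  qed (simp_all add: charlier_ip_add_right[OF a] charlier_ip_smult_right fdiff_def
      algebra_simps)
  then show ?thesis by simp
qed

lemma coeff_kernel01_poly: "n \<le> i \<Longrightarrow> coeff (kernel01_poly a c n) i = 0"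
  by (auto simp: kernel01_poly_def coeff_sum degree_charlier coeff_eq_0 intro!: sum.neutral)

section \<open>The explicit polynomials are the monic orthogonal sequence\<close>

lemma sobolev_charlier_explicit_monic:
  shows "degree (sobolev_charlier_explicit a c l n) = n"
    and "lead_coeff (sobolev_charlier_explicit a c l n) = 1"
proof -
  let ?Q = "sobolev_charlier_explicit a c l n"
  have c1: "coeff ?Q n = 1"
    using lead_coeff_charlier[of a n]
    by (simp add: sobolev_charlier_explicit_def coeff_kernel01_poly degree_charlier)
  have "degree ?Q \<le> n"
    by (rule degree_le) (simp add: sobolev_charlier_explicit_def coeff_kernel01_poly
        coeff_eq_0 degree_charlier)
  with c1 show "degree ?Q = n" by (intro antisym le_degree) auto
  with c1 show "lead_coeff ?Q = 1" by simp
qed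

text \<open>\<open>C_n\<close> is orthogonal to \<open>p\<close> and the kernel polynomial
  reproduces \<Delta>\<open>p(c)\<close>, so everything is a multiple of
  \<Delta>\<open>p(c)\<close>; the coefficient in the definition makes the multiple zero.\<close>

lemma sobolev_ip_explicit_eq_0:
  assumes a: "0 < a" and l: "0 \<le> l" and p: "\<forall>i\<ge>n. coeff p i = 0"
  shows "sobolev_ip a c l (sobolev_charlier_explicit a c l n) p = 0"
proof -
  define K where "K = kernel11 a c (int n - 1)"
  define d where "d = fdiff (poly (charlier a n)) c"
  have K: "1 + l * K \<noteq> 0"
    using kernel11_nonneg[OF a, of c n] l unfolding K_def
    by (smt (verit) mult_nonneg_nonneg)
  have C: "charlier_ip a (charlier a n) p = 0"
    by (rule linear_functional_eq_0[where P = "charlier a" and n = n,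
          OF _ _ degree_charlier lead_coeff_charlier _ p])
       (simp_all add: charlier_ip_add_right[OF a] charlier_ip_smult_right
          charlier_ip_charlier_eq_0[OF a])
  have "sobolev_ip a c l (sobolev_charlier_explicit a c l n) p =
      - (l * d / (1 + l * K)) * fdiff (poly p) c
      + l * (d - l * d / (1 + l * K) * K) * fdiff (poly p) c"
    by (simp add: sobolev_ip_def sobolev_charlier_explicit_def charlier_ip_diff_left[OF a] C
        charlier_ip_smult_left kernel01_poly_reproducing[OF a p] fdiff_poly_diff
        fdiff_poly_smult fdiff_kernel01_poly K_def d_def)
  also have "\<dots> = 0" using K by (simp add: field_simps)
  finally show ?thesis .
qed

text \<open>The definite description is resolved by existence, given by the explicit sequence, and
  by uniqueness, which rests on positive definiteness for \<open>l\<close> \<ge> 0.\<close>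

lemma sobolev_charlier_eq:
  assumes a: "0 < a" and l: "0 \<le> l"
  shows "sobolev_charlier a c l = sobolev_charlier_explicit a c l"
proof -
  let ?ip = "sobolev_ip a c l"
  have sym: "?ip p q = ?ip q p" for p q
    by (simp add: sobolev_ip_def charlier_ip_commute[of a p q])
  have add: "?ip p (q + r) = ?ip p q + ?ip p r" for p q r
    by (simp add: sobolev_ip_def charlier_ip_add_right[OF a] fdiff_poly_add distrib_left)
  have smult: "?ip p (smult r q) = r * ?ip p q" for p q r
    by (simp add: sobolev_ip_def charlier_ip_smult_right fdiff_poly_smult distrib_left)
  have pos: "0 < ?ip p p" if "p \<noteq> 0" for p
    using charlier_ip_pos[OF a that] l by (simp add: sobolev_ip_def mult.assoc add_pos_nonneg)
  have less: "?ip (sobolev_charlier_explicit a c l n) (sobolev_charlier_explicit a c l m) = 0"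
    if "m < n" for m n
    using that
    by (intro sobolev_ip_explicit_eq_0[OF a l] allI impI)
       (simp add: coeff_eq_0 sobolev_charlier_explicit_monic(1))
  have ex: "monic_orthogonal ?ip (sobolev_charlier_explicit a c l)"
    unfolding monic_orthogonal_def
    using less sym sobolev_charlier_explicit_monic by (metis linorder_neq_iff)
  show ?thesis
    unfolding sobolev_charlier_def
  proof (rule the_equality[where P = "monic_orthogonal ?ip", OF ex])
    show "P = sobolev_charlier_explicit a c l" if "monic_orthogonal ?ip P" for P
      using monic_orthogonal_unique[OF add smult sym pos that ex] by simp
  qed
qed

section \<open>The limit for large mass and the final identity\<close>

lemma poly_sobolev_charlier:
  assumes "0 < a" "0 \<le> l"
  shows "poly (sobolev_charlier a c l n) x = poly (charlier a n) x
    - l * fdiff (poly (charlier a n)) c / (1 + l * kernel11 a c (int n - 1))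
      * poly (kernel01_poly a c n) x"
  by (simp add: sobolev_charlier_eq[OF assms] sobolev_charlier_explicit_def)

text \<open>For \<open>n \<le> 1\<close> the kernel in the denominator is zero, and \<open>x / 0 = 0\<close> gives the correct
  limit.\<close>

lemma limit_charlier_eq:
  assumes a: "0 < a"
  shows "limit_charlier a c n x = poly (charlier a n) x
    - fdiff (poly (charlier a n)) c / kernel11 a c (int n - 1) * poly (kernel01_poly a c n) x"
proof -
  define K where "K = kernel11 a c (int n - 1)"
  define d where "d = fdiff (poly (charlier a n)) c"
  define k where "k = poly (kernel01_poly a c n) x"
  have "((\<lambda>l. l * d / (1 + l * K) * k) \<longlongrightarrow> d / K * k) at_top"
  proof (cases "K = 0")
    case True
    then show ?thesis using kernel01_poly_eq_0[OF a] by (simp add: K_def k_def)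
  next
    case False
    then have "0 < K" using kernel11_nonneg[OF a, of c n] by (simp add: K_def)
    have "((\<lambda>l. inverse l) \<longlongrightarrow> (0::real)) at_top"
      by (rule tendsto_inverse_0_at_top) (rule filterlim_ident)
    \<comment> \<open>Numerator and denominator are divided by \<open>l\<close>, so that only
      \<open>inverse l\<close> depends on it.\<close>
    then have "((\<lambda>l. d / (inverse l + K) * k) \<longlongrightarrow> d / (0 + K) * k) at_top"
      using False by (intro tendsto_intros) auto
    moreover have "\<forall>\<^sub>F l in at_top. d / (inverse l + K) * k = l * d / (1 + l * K) * k"
      using eventually_gt_at_top[of 0]
      by eventually_elim (use \<open>0 < K\<close> in \<open>simp add: field_simps\<close>)
    ultimately show ?thesis using filterlim_cong[OF refl refl] by force
  qed
  then have lim: "((\<lambda>l. poly (charlier a n) x - l * d / (1 + l * K) * k)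
      \<longlongrightarrow> poly (charlier a n) x - d / K * k) at_top"
    by (rule tendsto_diff[OF tendsto_const])
  have "\<forall>\<^sub>F l in at_top. poly (charlier a n) x - l * d / (1 + l * K) * k
      = poly (sobolev_charlier a c l n) x"
    using eventually_ge_at_top[of 0]
    by eventually_elim (simp add: poly_sobolev_charlier[OF a] K_def d_def k_def)
  from Lim_transform_eventually[OF lim this] show ?thesis
    unfolding limit_charlier_def K_def d_def k_def
    by (intro tendsto_Lim) auto
qed

theorem proposition5:
  fixes a l c :: real
  assumes "0 < a" and "0 \<le> l" and "c \<in> UNIV - {-1..}"
  shows "(\<forall>n x. poly (scaled_sobolev_charlier a c l n) x =
              poly (charlier a n) x + l * kernel11 a c (int n - 1) * limit_charlier a c n x)
       \<and> (\<forall>n\<ge>2. kernel11 a c (int n - 1) > 0)"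
proof (intro conjI allI impI)
  fix n x
  define K where "K = kernel11 a c (int n - 1)"
  define d where "d = fdiff (poly (charlier a n)) c"
  define k where "k = poly (kernel01_poly a c n) x"
  define C where "C = poly (charlier a n) x"
  have "0 \<le> K" using kernel11_nonneg[OF assms(1)] by (simp add: K_def)
  then have pos: "0 < 1 + l * K" using assms(2) by (simp add: add_pos_nonneg)
  have zero: "K = 0 \<Longrightarrow> k = 0"
    using kernel01_poly_eq_0[OF assms(1)] by (simp add: K_def k_def)
  have "poly (scaled_sobolev_charlier a c l n) x = (1 + l * K) * (C - l * d / (1 + l * K) * k)"
    by (simp add: scaled_sobolev_charlier_def poly_sobolev_charlier[OF assms(1,2)]
        K_def d_def k_def C_def)
  \<comment> \<open>The scaling factor is exactly the denominator and is positive.\<close>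
  also have "\<dots> = (1 + l * K) * C - l * d * k"
    using pos by (simp add: right_diff_distrib)
  \<comment> \<open>If \<open>K = 0\<close>, then \<open>k = 0\<close> and both sides equal
    \<open>C\<close>; otherwise \<open>K\<close> cancels.\<close>
  also have "\<dots> = C + l * K * (C - d / K * k)"
    using zero by (cases "K = 0") (simp_all add: algebra_simps)
  finally show "poly (scaled_sobolev_charlier a c l n) x =
      poly (charlier a n) x + l * kernel11 a c (int n - 1) * limit_charlier a c n x"
    by (simp add: limit_charlier_eq[OF assms(1)] K_def d_def k_def C_def)
qed (rule kernel11_pos[OF assms(1)])

end
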